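(* For $u\notin\mathbf{Z}_0^-$, $$\psi(u)=\sum_{k=0}^{\infty}\frac{1}{k+1}\sum_{j=0}^{k}\binom{k}{j}(-1)^j\log(u+j).$$
   Context: $\psi(u)=\frac{d}{du}\log\Gamma(u)=\Gamma'(u)/\Gamma(u)$ is the digamma function, where $\Gamma$ is the gamma function; $\log$ is the natural logarithm; and $\mathbf{Z}_0^-=\{0,-1,-2,\ldots\}$ is the set of non-positive integers.
   Formalization: The condition Re u ≥ 0 is added (log is the principal branch): for Re u < 0 the series diverges, e.g. for real u in (−1,0) the imaginary part of the k-th term is π/(k+1). *)

theory Defs
  imports "HOL-Analysis.Analysis"
begin

text \<open>
  The library introduces \<open>Digamma\<close> by a series; the next lemma confirms that it is the
  logarithmic derivative of \<open>Gamma\<close> away from the non-positive integers.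
\<close>

lemma Digamma_eq_deriv_Gamma_divide_Gamma:
  fixes u :: complex
  assumes "u \<notin> \<int>\<^sub>\<le>\<^sub>0"
  shows "Digamma u = deriv Gamma u / Gamma u"
proof -
  have "deriv Gamma u = Gamma u * Digamma u"
    using assms by (intro DERIV_imp_deriv has_field_derivative_Gamma)
  then show ?thesis
    using assms by (simp add: Gamma_eq_zero_iff)
qed

text \<open>
  The digamma series converges only in the closed right half-plane. The next lemma shows why a
  condition on \<open>Re u\<close> cannot be omitted: on the real interval from \<open>-1\<close> to \<open>0\<close> the imaginary
  parts of the terms form a multiple of the harmonic series, because the principal logarithm
  contributes \<open>pi\<close> for \<open>j = 0\<close> and is real for \<open>j > 0\<close>.
\<close>

lemma digamma_series_diverges:
  fixes x :: real
  assumes "-1 < x" "x < 0"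
  shows "\<not> summable (\<lambda>k. 1 / of_nat (k + 1) *
           (\<Sum>j=0..k. of_nat (k choose j) * (-1) ^ j * ln (complex_of_real x + of_nat j)))"
    (is "\<not> summable ?a")
proof
  assume "summable ?a"
  then have "summable (\<lambda>k. Im (?a k))"
    by (rule summable_Im)
  moreover have "Im (?a k) = pi * (1 / real (k + 1))" for k
  proof -
    have 1: "Im (of_nat (k choose j) * (-1) ^ j * ln (complex_of_real x + of_nat j)) =
               (if j = 0 then pi else 0)" for j
    proof (cases "j = 0")
      case True
      have "Im (ln (complex_of_real x)) = pi"
        using assms Im_Ln_eq_pi[of "complex_of_real x"] by auto
      then show ?thesis using True by simp
    next
      case False
      then have pos: "0 < x + real j"
        using assms by linarith
      have "complex_of_real x + of_nat j = complex_of_real (x + real j)"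
        by simp
      then have "ln (complex_of_real x + of_nat j) = complex_of_real (ln (x + real j))"
        using pos by (simp only: Ln_of_real)
      moreover have "of_nat (k choose j) * (-1) ^ j =
                       complex_of_real (real (k choose j) * (-1) ^ j)"
        by simp
      ultimately have "of_nat (k choose j) * (-1) ^ j * ln (complex_of_real x + of_nat j) =
                       complex_of_real (real (k choose j) * (-1) ^ j * ln (x + real j))"
        by (simp only: of_real_mult)
      then show ?thesis
        using False by (simp only: Im_complex_of_real if_False)
    qed
    have scale: "Im (1 / of_nat (k + 1) * z) = 1 / real (k + 1) * Im z" for z
      using Im_divide_of_nat[of z "k + 1"] by simp
    have "Im (?a k) = 1 / real (k + 1) *
        (\<Sum>j=0..k. Im (of_nat (k choose j) * (-1) ^ j * ln (complex_of_real x + of_nat j)))"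
      unfolding scale Im_sum ..
    also have "\<dots> = 1 / real (k + 1) * pi"
      unfolding 1 by (simp add: sum.delta)
    finally show ?thesis
      by simp
  qed
  ultimately have "summable (\<lambda>k. pi * (1 / real (k + 1)))"
    by (simp only:)
  then have "summable (\<lambda>k. 1 / real (k + 1))"
    by (rule summable_mult_D) simp
  then have "summable (\<lambda>k. inverse (real (Suc k)))"
    by (simp only: inverse_eq_divide Suc_eq_plus1)
  then have "summable (\<lambda>k. inverse (real k))"
    by (rule summable_Suc_iff[THEN iffD1])
  then show False
    using not_summable_harmonic[where 'a = real] by simp
qed

end

theory Submission
  imports Defs
begin

text \<open>
  Write \<open>L\<^sub>k(u)\<close> for the alternating sum \<open>\<Sum>j\<le>k. (k choose j) (-1)^j ln (u + j)\<close>, so that the series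
  in question is \<open>F(u) = \<Sum>k. L\<^sub>k(u) / (k + 1)\<close>. By Pascal's rule \<open>L\<^sub>k\<close> is an iterated difference,
  \<open>L\<^sub>k(u) - L\<^sub>k(u + 1) = L\<^sub>k\<^sub>+\<^sub>1(u)\<close>, and its derivative is the rational function
  \<open>B\<^sub>k(u) = k! / (u (u + 1) \<dots> (u + k))\<close>. The proof is elementary and rests on two facts.

  The first is the Newton expansion \<open>D = ln (1 + \<Delta>)\<close> applied to the logarithm, that is,
  \<open>\<Sum>k. L\<^sub>k\<^sub>+\<^sub>1(u) / (k + 1) = - 1 / u\<close> for \<open>Re u \<ge> 0\<close> and \<open>u \<noteq> 0\<close>
  (lemma \<open>newton_series_sums\<close>). The relation \<open>u B\<^sub>k\<^sub>+\<^sub>1 = (k + 1) (B\<^sub>k - B\<^sub>k\<^sub>+\<^sub>1)\<close> makes the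
  differentiated series telescope, so the error after \<open>n\<close> terms has the derivative
  \<open>- B\<^sub>n(u) / u\<close>. Since the error vanishes as \<open>Re u \<rightarrow> \<infinity>\<close>, integrating along a horizontal ray
  bounds it by \<open>B\<^sub>n(Re u)\<close>, which tends to 0 if \<open>Re u > 0\<close>. The imaginary axis is reached by
  moving \<open>u\<close> a small distance to the right: there \<open>B\<^sub>n(s) / s\<close> is at most \<open>1 / |u|\<^sup>2\<close>,
  uniformly in \<open>n\<close>. In terms of \<open>F\<close> this is the functional equation
  \<open>F(u) = F(u + 1) - 1 / u\<close>, including the convergence of the left-hand side
  (lemma \<open>log_mean_sums_shift\<close>).

  The second is that \<open>F(u)\<close> converges for \<open>Re u \<ge> 1\<close> with \<open>F(u) - ln u = O(1 / Re u)\<close>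
  (lemma \<open>log_mean_summable\<close>), because \<open>|L\<^sub>k(u)| \<le> 2 / ((k + 1) Re u)\<close> for \<open>k \<ge> 1\<close>.

  Iterating the functional equation gives
  \<open>F(u) = lim\<^sub>n (ln n - \<Sum>k<n. 1 / (u + k))\<close>, which is the digamma function, for \<open>Re u \<ge> 1\<close>;
  one more application extends this to \<open>Re u \<ge> 0\<close>.
\<close>

section \<open>Iterated differences\<close>

text \<open>
  The \<open>k\<close>-th difference \<open>(1 - E)^k f\<close> with \<open>E\<close> the unit shift, written as an
  alternating binomial sum. The sign convention avoids a factor \<open>(-1)^k\<close>.
\<close>

definition alt_diff :: "nat \<Rightarrow> (complex \<Rightarrow> complex) \<Rightarrow> complex \<Rightarrow> complex" where
  "alt_diff k f u = (\<Sum>j=0..k. of_nat (k choose j) * (-1) ^ j * f (u + of_nat j))"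

lemma alt_diff_0 [simp]: "alt_diff 0 f u = f u"
  by (simp add: alt_diff_def)

lemma alt_diff_Suc: "alt_diff (Suc k) f u = alt_diff k f u - alt_diff k f (u + 1)"
proof -
  let ?g = "\<lambda>j. (-1) ^ j * f (u + of_nat j)"
  have "alt_diff (Suc k) f u = ?g 0 + (\<Sum>j=0..k. of_nat (Suc k choose Suc j) * ?g (Suc j))"
    by (simp add: alt_diff_def sum.atLeast0_atMost_Suc_shift mult.assoc del: binomial_Suc_Suc sum.cl_ivl_Suc)
  also have "\<dots> = (?g 0 + (\<Sum>j=0..k. of_nat (k choose Suc j) * ?g (Suc j)))
                  + (\<Sum>j=0..k. of_nat (k choose j) * ?g (Suc j))"
    by (simp only: binomial_Suc_Suc of_nat_add distrib_right sum.distrib) simp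
  also have "?g 0 + (\<Sum>j=0..k. of_nat (k choose Suc j) * ?g (Suc j))
      = (\<Sum>j=0..Suc k. of_nat (k choose j) * ?g j)"
    by (simp add: sum.atLeast0_atMost_Suc_shift del: sum.cl_ivl_Suc)
  also have "\<dots> = alt_diff k f u"
    by (simp add: alt_diff_def mult.assoc)
  also have "(\<Sum>j=0..k. of_nat (k choose j) * ?g (Suc j)) = - alt_diff k f (u + 1)"
    by (simp add: alt_diff_def sum_negf [symmetric] algebra_simps)
  finally show ?thesis
    by simp
qed

section \<open>The kernel \<open>k! / (s (s + 1) \<dots> (s + k))\<close>\<close>

text \<open>
  The value \<open>B(s, k + 1)\<close> of the Beta function, as a rational function of \<open>s\<close>. It is polymorphic
  because the kernel at a complex point is compared with the kernel at its real part.
\<close>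

definition beta_kernel :: "nat \<Rightarrow> 'a :: real_normed_field \<Rightarrow> 'a" where
  "beta_kernel k s = fact k / pochhammer s (Suc k)"

lemma beta_kernel_0 [simp]: "beta_kernel 0 s = 1 / s"
  by (simp add: beta_kernel_def)

lemma beta_kernel_Suc:
  "beta_kernel (Suc k) s = beta_kernel k s * (of_nat (Suc k) / (s + of_nat (Suc k)))"
  by (simp add: beta_kernel_def pochhammer_Suc[of s "Suc k"])

lemma add_of_nat_neq_0:
  fixes s :: complex
  assumes "s \<noteq> 0" "0 \<le> Re s"
  shows "s + of_nat j \<noteq> 0"
proof
  assume "s + of_nat j = 0"
  then have "Re s = - real j" "Im s = 0"
    by (auto simp: complex_eq_iff)
  with assms show False
    by (auto simp: complex_eq_iff)
qed

lemma beta_kernel_eq_alt_diff: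
  assumes "s \<noteq> 0" "0 \<le> Re s"
  shows "alt_diff k inverse s = beta_kernel k s"
  using assms
proof (induction k arbitrary: s)
  case 0
  then show ?case by (simp add: inverse_eq_divide)
next
  case (Suc k)
  define P where "P = pochhammer (s + 1) k"
  define a where "a = s + of_nat (Suc k)"
  have nz: "s + of_nat j \<noteq> 0" for j
    using add_of_nat_neq_0 Suc.prems by blast
  have P: "P \<noteq> 0"
  proof
    assume "P = 0"
    then obtain j where "s + 1 = - of_nat j"
      unfolding P_def pochhammer_eq_0_iff by auto
    then show False
      using nz[of "Suc j"] by (simp add: eq_neg_iff_add_eq_0 add_ac)
  qed
  have a: "a \<noteq> 0"
    unfolding a_def by (rule nz)
  have s1: "s + 1 \<noteq> 0" "0 \<le> Re (s + 1)"
    using nz[of 1] Suc.prems by auto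
  have e1: "pochhammer s (Suc k) = s * P"
    by (simp add: P_def pochhammer_rec)
  have e2: "pochhammer (s + 1) (Suc k) = P * a"
    by (simp add: P_def a_def pochhammer_Suc algebra_simps)
  have e3: "pochhammer s (Suc (Suc k)) = s * P * a"
    by (metis e2 mult.assoc pochhammer_rec)
  have "alt_diff (Suc k) inverse s = beta_kernel k s - beta_kernel k (s + 1)"
    using Suc.IH[OF Suc.prems] Suc.IH[OF s1] by (simp add: alt_diff_Suc)
  also have "\<dots> = fact k * (a - s) / (s * P * a)"
    using P a Suc.prems unfolding beta_kernel_def e1 e2 by (simp add: field_simps)
  also have "\<dots> = beta_kernel (Suc k) s"
    unfolding beta_kernel_def e3 by (simp add: a_def algebra_simps)
  finally show ?case .
qed

lemma norm_beta_kernel_le_inverse: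
  fixes s :: complex
  assumes "s \<noteq> 0" "0 \<le> Re s"
  shows "norm (beta_kernel k s) \<le> 1 / norm s"
proof (induction k)
  case (Suc k)
  have "real (Suc k) \<le> Re (s + of_nat (Suc k))"
    using assms by simp
  also have "\<dots> \<le> norm (s + of_nat (Suc k))"
    by (rule complex_Re_le_cmod)
  finally have "norm (of_nat (Suc k) / (s + of_nat (Suc k))) \<le> 1"
    by (simp only: norm_divide norm_of_nat) (simp add: divide_le_eq_1)
  then have "norm (beta_kernel k s) * norm (of_nat (Suc k) / (s + of_nat (Suc k))) \<le> norm (beta_kernel k s) * 1"
    by (intro mult_left_mono) auto
  then show ?case
    using Suc unfolding beta_kernel_Suc norm_mult by linarith
qed (simp add: norm_divide)

lemma norm_beta_kernel_le_Re:
  assumes "0 < Re s"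
  shows "norm (beta_kernel k s) \<le> beta_kernel k (Re s)"
proof (induction k)
  case 0
  then show ?case
    using assms complex_Re_le_cmod[of s] by (simp add: norm_divide frac_le)
next
  case (Suc k)
  have "Re s + real (Suc k) \<le> norm (s + of_nat (Suc k))"
    using complex_Re_le_cmod[of "s + of_nat (Suc k)"] by simp
  then have "norm (of_nat (Suc k) / (s + of_nat (Suc k))) \<le> real (Suc k) / (Re s + real (Suc k))"
    unfolding norm_divide norm_of_nat using assms by (intro frac_le) auto
  then show ?case
    unfolding beta_kernel_Suc norm_mult using Suc by (intro mult_mono) (auto intro: order_trans[OF norm_ge_zero])
qed

lemma beta_kernel_nonneg: "0 < (x :: real) \<Longrightarrow> 0 \<le> beta_kernel k x"
  by (simp add: beta_kernel_def pochhammer_nonneg)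

text \<open>The product is \<open>k! / ((x + 1) \<dots> (x + k))\<close>, which decreases in \<open>x\<close>.\<close>

lemma mult_beta_kernel_antimono:
  fixes x y :: real
  assumes "0 < x" "x \<le> y"
  shows "y * beta_kernel k y \<le> x * beta_kernel k x"
proof (induction k)
  case (Suc k)
  have "(y * beta_kernel k y) * (real (Suc k) / (y + real (Suc k)))
      \<le> (x * beta_kernel k x) * (real (Suc k) / (x + real (Suc k)))"
  proof (rule mult_mono[OF Suc])
    show "real (Suc k) / (y + real (Suc k)) \<le> real (Suc k) / (x + real (Suc k))"
      using assms by (intro frac_le) auto
  qed (use assms beta_kernel_nonneg[of x k] in auto)
  then show ?case
    by (simp add: beta_kernel_Suc mult.assoc)
qed (use assms in simp)

text \<open>By Euler's limit formula for \<open>Gamma\<close>, the kernel at \<open>x\<close> behaves like \<open>Gamma x * k powr (-x)\<close>.\<close>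

lemma beta_kernel_tendsto_0:
  assumes "0 < (x :: real)"
  shows "(\<lambda>k. beta_kernel k x) \<longlonglongrightarrow> 0"
proof -
  have "(\<lambda>k. Gamma_series x k * real k powr (-x)) \<longlonglongrightarrow> Gamma x * 0"
    using assms by (intro tendsto_mult Gamma_series_LIMSEQ tendsto_neg_powr filterlim_real_sequentially) auto
  moreover have "eventually (\<lambda>k. Gamma_series x k * real k powr (-x) = beta_kernel k x) sequentially"
    using eventually_gt_at_top[of 0]
    by eventually_elim (simp add: Gamma_series_def beta_kernel_def powr_def exp_minus)
  ultimately show ?thesis
    by (simp add: tendsto_cong)
qed

lemma beta_kernel_le:
  assumes "1 \<le> (x :: real)"
  shows "beta_kernel (Suc k) x \<le> 2 / real (k + 2) / x\<^sup>2"
proof (induction k)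
  case 0
  have "beta_kernel (Suc 0) x = 1 / (x * (x + 1))"
    by (simp add: beta_kernel_Suc)
  also have "\<dots> \<le> 1 / x\<^sup>2"
    using assms by (intro frac_le) (auto simp: power2_eq_square)
  finally show ?case by simp
next
  case (Suc k)
  have "beta_kernel (Suc (Suc k)) x \<le> (2 / real (k + 2) / x\<^sup>2) * (real (k + 2) / real (k + 3))"
    unfolding beta_kernel_Suc[of "Suc k"]
    using Suc assms by (intro mult_mono frac_le) auto
  also have "\<dots> = 2 / real (Suc k + 2) / x\<^sup>2"
  proof -
    have "2 / p / y * (p / q) = 2 / q / y" if "0 < p" for p q y :: real
      using that by simp
    moreover have "real (Suc k + 2) = real (k + 3)"
      by simp
    ultimately show ?thesis
      by (metis add_2_eq_Suc' of_nat_0_less_iff zero_less_Suc)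
  qed
  finally show ?case .
qed

text \<open>
  With \<open>B\<^sub>k\<close> the kernel, \<open>s B\<^sub>k\<^sub>+\<^sub>1(s) = (k + 1) (B\<^sub>k(s) - B\<^sub>k\<^sub>+\<^sub>1(s))\<close>, so the sum telescopes.
\<close>

lemma sum_beta_kernel:
  fixes s :: complex
  assumes "s \<noteq> 0" "0 \<le> Re s"
  shows "(\<Sum>k<n. beta_kernel (Suc k) s / of_nat (Suc k)) = 1 / s\<^sup>2 - beta_kernel n s / s"
proof (induction n)
  case 0
  then show ?case by (simp add: power2_eq_square)
next
  case (Suc n)
  have "s + of_nat (Suc n) \<noteq> 0"
    using add_of_nat_neq_0 assms by blast
  moreover have "(of_nat (Suc n) :: complex) \<noteq> 0"
    by (simp del: of_nat_Suc)
  moreover have "b * (m / (s + m)) / m = (b - b * (m / (s + m))) / s"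
    if "s + m \<noteq> 0" "m \<noteq> 0" for b m
  proof -
    have "b - b * (m / (s + m)) = b * s / (s + m)"
      using that by (simp add: field_simps)
    then show ?thesis
      using that assms by simp
  qed
  ultimately have "beta_kernel (Suc n) s / of_nat (Suc n) = (beta_kernel n s - beta_kernel (Suc n) s) / s"
    unfolding beta_kernel_Suc by blast
  then show ?case
    using Suc by (simp add: diff_divide_distrib)
qed


section \<open>Differences of the logarithm\<close>

text \<open>
  A function that vanishes at the far end of a horizontal ray is controlled by its derivative.
  This replaces integration of \<open>C / x\<^sup>2\<close> over the ray by the mean value inequality.
\<close>

lemma norm_le_of_ray_deriv_bound:
  fixes G g :: "complex \<Rightarrow> complex"
  assumes "0 < Re u"
    and deriv: "\<And>s. Im s = Im u \<Longrightarrow> Re u \<le> Re s \<Longrightarrow> (G has_field_derivative g s) (at s)"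
    and bound: "\<And>s. Im s = Im u \<Longrightarrow> Re u \<le> Re s \<Longrightarrow> norm (g s) \<le> C / (Re s)\<^sup>2"
    and lim: "((\<lambda>r. G (u + of_real r)) \<longlongrightarrow> 0) at_top"
  shows "norm (G u) \<le> C / Re u"
proof -
  define \<phi> where "\<phi> r = - C / (Re u + r)" for r
  have "0 \<le> C / (Re u)\<^sup>2"
    using bound[of u] norm_ge_zero[of "g u"] by linarith
  then have C: "0 \<le> C"
    using assms(1) by (auto simp: zero_le_divide_iff)
  have "norm (G (u + of_real r) - G u) \<le> C / Re u" if "0 < r" for r
  proof -
    have dG: "((\<lambda>x. G (u + of_real x)) has_vector_derivative g (u + of_real x)) (at x)" if "0 \<le> x" for x
    proof -
      have "((\<lambda>z. G (u + z)) has_field_derivative g (u + of_real x)) (at (of_real x))"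
        using DERIV_shift[of G "g (u + of_real x)" "of_real x" u] deriv[of "u + of_real x"] that
        by (simp add: add.commute)
      then show ?thesis
        by (rule has_vector_derivative_real_field)
    qed
    have d\<phi>: "(\<phi> has_vector_derivative C / (Re u + x)\<^sup>2) (at x)" if "0 \<le> x" for x
      unfolding \<phi>_def has_real_derivative_iff_has_vector_derivative [symmetric]
      using assms(1) that by (auto intro!: derivative_eq_intros simp: power2_eq_square)
    have "norm (G (u + of_real r) - G (u + of_real 0)) \<le> \<phi> r - \<phi> 0"
    proof (rule differentiable_bound_general[OF \<open>0 < r\<close>, where f = "\<lambda>x. G (u + of_real x)"
          and f' = "\<lambda>x. g (u + of_real x)" and \<phi>' = "\<lambda>x. C / (Re u + x)\<^sup>2"])
      show "continuous_on {0..r} (\<lambda>x. G (u + of_real x))"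
        by (intro continuous_at_imp_continuous_on ballI has_vector_derivative_continuous[OF dG]) auto
      show "continuous_on {0..r} \<phi>"
        by (intro continuous_at_imp_continuous_on ballI has_vector_derivative_continuous[OF d\<phi>]) auto
      show "norm (g (u + of_real x)) \<le> C / (Re u + x)\<^sup>2" if "0 < x" for x
        using bound[of "u + of_real x"] that by simp
    qed (use dG d\<phi> in auto)
    moreover have "0 \<le> C / (Re u + r)"
      using C assms(1) that by simp
    ultimately show ?thesis
      by (simp add: \<phi>_def)
  qed
  with eventually_gt_at_top[of "0::real"] have "eventually (\<lambda>r. norm (G (u + of_real r) - G u) \<le> C / Re u) at_top"
    by (rule eventually_mono)
  moreover have "((\<lambda>r. norm (G (u + of_real r) - G u)) \<longlongrightarrow> norm (0 - G u)) at_top"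
    by (intro tendsto_intros lim)
  ultimately have "norm (0 - G u) \<le> C / Re u"
    by (intro tendsto_upperbound) auto
  then show ?thesis
    by simp
qed

lemma not_nonpos_Reals:
  assumes "s \<noteq> 0" "0 \<le> Re s"
  shows "s \<notin> \<real>\<^sub>\<le>\<^sub>0"
  using assms by (auto simp: complex_nonpos_Reals_iff complex_eq_iff)

lemma has_field_derivative_alt_diff_ln:
  assumes "s \<noteq> 0" "0 \<le> Re s"
  shows "(alt_diff k ln has_field_derivative beta_kernel k s) (at s)"
proof -
  have "(alt_diff k ln has_field_derivative alt_diff k inverse s) (at s)"
    unfolding alt_diff_def[abs_def]
  proof (intro DERIV_sum DERIV_cmult)
    show "((\<lambda>u. ln (u + of_nat j)) has_field_derivative inverse (s + of_nat j)) (at s)" for j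
    proof -
      have "s + of_nat j \<notin> \<real>\<^sub>\<le>\<^sub>0"
        using add_of_nat_neq_0[OF assms, of j] assms by (intro not_nonpos_Reals) auto
      then show ?thesis
        by (auto intro!: derivative_eq_intros simp: inverse_eq_divide)
    qed
  qed
  then show ?thesis
    using beta_kernel_eq_alt_diff[OF assms] by simp
qed

text \<open>
  The order of the difference is positive here; the logarithm itself is unbounded.
\<close>

lemma alt_diff_ln_tendsto_0:
  "((\<lambda>r. alt_diff (Suc k) ln (u + of_real r)) \<longlongrightarrow> 0) at_top"
proof (induction k arbitrary: u)
  case 0
  have *: "norm (ln (s + 1) - ln s) \<le> 1 / Re s" if "0 < Re s" for s
  proof -
    have "norm (ln (s + 1) - ln s) \<le> 1 / Re s * norm ((s + 1) - s)"
    proof (rule field_differentiable_bound[where S = "{z. Re s \<le> Re z}" and f' = inverse])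
      show "convex {z. Re s \<le> Re z}"
        by (rule convex_halfspace_Re_ge)
      show "(ln has_field_derivative inverse z) (at z within {z. Re s \<le> Re z})"
        if "z \<in> {z. Re s \<le> Re z}" for z
      proof -
        have "z \<notin> \<real>\<^sub>\<le>\<^sub>0"
          using that \<open>0 < Re s\<close> by (auto simp: complex_nonpos_Reals_iff)
        then show ?thesis
          by (intro has_field_derivative_at_within[OF has_field_derivative_Ln])
      qed
      show "norm (inverse z) \<le> 1 / Re s" if "z \<in> {z. Re s \<le> Re z}" for z
        using that \<open>0 < Re s\<close> complex_Re_le_cmod[of z]
        by (simp add: inverse_eq_divide norm_divide frac_le)
    qed auto
    then show ?thesis by simp
  qed
  have "eventually (\<lambda>r. norm (alt_diff (Suc 0) ln (u + of_real r)) \<le> 1 / (Re u + r)) at_top"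
    using eventually_gt_at_top[of "- Re u"]
  proof eventually_elim
    case (elim r)
    then show ?case
      using *[of "u + of_real r"] by (simp add: alt_diff_Suc norm_minus_commute)
  qed
  moreover have "((\<lambda>r. 1 / (Re u + r)) \<longlongrightarrow> 0) at_top"
    by (intro tendsto_divide_0[OF tendsto_const] filterlim_at_top_imp_at_infinity
        filterlim_tendsto_add_at_top[OF tendsto_const] filterlim_ident)
  ultimately show ?case
    by (rule Lim_null_comparison)
next
  case (Suc k)
  have "((\<lambda>r. alt_diff (Suc k) ln (u + of_real r) - alt_diff (Suc k) ln (u + 1 + of_real r)) \<longlongrightarrow> 0 - 0) at_top"
    by (intro tendsto_diff Suc)
  then show ?case
    by (simp add: alt_diff_Suc[of "Suc k"] algebra_simps)
qed

lemma norm_alt_diff_ln_le: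
  assumes "1 \<le> Re u"
  shows "norm (alt_diff (Suc k) ln u) \<le> 2 / real (k + 2) / Re u"
proof (rule norm_le_of_ray_deriv_bound[where g = "beta_kernel (Suc k)"])
  fix s assume "Re u \<le> Re s"
  with assms have s: "1 \<le> Re s" by linarith
  then show "(alt_diff (Suc k) ln has_field_derivative beta_kernel (Suc k) s) (at s)"
    by (intro has_field_derivative_alt_diff_ln) auto
  have "norm (beta_kernel (Suc k) s) \<le> beta_kernel (Suc k) (Re s)"
    using s by (intro norm_beta_kernel_le_Re) auto
  also have "\<dots> \<le> 2 / real (k + 2) / (Re s)\<^sup>2"
    using s by (rule beta_kernel_le)
  finally show "norm (beta_kernel (Suc k) s) \<le> 2 / real (k + 2) / (Re s)\<^sup>2" .
qed (use assms alt_diff_ln_tendsto_0 in auto)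

section \<open>The Newton series for the derivative of the logarithm\<close>

text \<open>
  The error of the \<open>n\<close>-th partial sum of the Newton series, relative to its limit \<open>- 1 / u\<close>.
\<close>

definition newton_rem :: "nat \<Rightarrow> complex \<Rightarrow> complex" where
  "newton_rem n u = (\<Sum>k<n. alt_diff (Suc k) ln u / of_nat (Suc k)) + 1 / u"

lemma has_field_derivative_newton_rem:
  assumes "s \<noteq> 0" "0 \<le> Re s"
  shows "(newton_rem n has_field_derivative - (beta_kernel n s / s)) (at s)"
proof -
  have "(newton_rem n has_field_derivative
      (\<Sum>k<n. beta_kernel (Suc k) s / of_nat (Suc k)) + (- 1 / s\<^sup>2)) (at s)"
    unfolding newton_rem_def[abs_def] using assms
    by (intro derivative_intros DERIV_sum DERIV_cdivide has_field_derivative_alt_diff_ln)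
       (auto intro!: derivative_eq_intros simp: power2_eq_square)
  then show ?thesis
    using sum_beta_kernel[OF assms, of n] by simp
qed

lemma newton_rem_tendsto_0_at_top:
  "((\<lambda>r. newton_rem n (u + of_real r)) \<longlongrightarrow> 0) at_top"
proof -
  have inf: "filterlim (\<lambda>r. u + complex_of_real r) at_infinity at_top"
    by (intro tendsto_add_filterlim_at_infinity[OF tendsto_const] filterlim_of_real_at_infinity)
  have "((\<lambda>r. newton_rem n (u + of_real r)) \<longlongrightarrow> (\<Sum>k<n. 0 / of_nat (Suc k)) + 0) at_top"
    unfolding newton_rem_def
    by (intro tendsto_add tendsto_sum tendsto_divide alt_diff_ln_tendsto_0 tendsto_const
        tendsto_divide_0[OF tendsto_const inf]) (auto simp del: of_nat_Suc)
  then show ?thesis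
    by simp
qed

lemma norm_newton_rem_le:
  assumes "0 < Re u"
  shows "norm (newton_rem n u) \<le> beta_kernel n (Re u)"
proof -
  have "norm (newton_rem n u) \<le> Re u * beta_kernel n (Re u) / Re u"
  proof (rule norm_le_of_ray_deriv_bound[where g = "\<lambda>s. - (beta_kernel n s / s)"])
    fix s assume "Re u \<le> Re s"
    then have s: "0 < Re s" "Re u \<le> Re s"
      using assms by linarith+
    then show "(newton_rem n has_field_derivative - (beta_kernel n s / s)) (at s)"
      by (intro has_field_derivative_newton_rem) auto
    have "norm (- (beta_kernel n s / s)) \<le> beta_kernel n (Re s) / Re s"
      unfolding norm_minus_cancel norm_divide using s complex_Re_le_cmod[of s]
      by (intro frac_le norm_beta_kernel_le_Re beta_kernel_nonneg) auto
    also have "\<dots> = (Re s * beta_kernel n (Re s)) / (Re s)\<^sup>2"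
      using s by (simp add: power2_eq_square)
    also have "\<dots> \<le> (Re u * beta_kernel n (Re u)) / (Re s)\<^sup>2"
      using s assms by (intro divide_right_mono mult_beta_kernel_antimono) auto
    finally show "norm (- (beta_kernel n s / s)) \<le> Re u * beta_kernel n (Re u) / (Re s)\<^sup>2" .
  qed (use assms newton_rem_tendsto_0_at_top in auto)
  then show ?thesis
    using assms by simp
qed

text \<open>
  The bound by the kernel at \<open>Re u\<close> does not cover \<open>Re u = 0\<close>, so \<open>u\<close> is moved to the right by
  an amount \<open>d\<close> that depends on \<open>e\<close> but not on \<open>n\<close>.
\<close>

lemma newton_rem_tendsto_0:
  assumes "u \<noteq> 0" "0 \<le> Re u"
  shows "(\<lambda>n. newton_rem n u) \<longlonglongrightarrow> 0"
proof (rule tendstoI)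
  fix e :: real assume e: "0 < e"
  \<comment> \<open>The derivative of the error is at most \<open>1 / |u|\<^sup>2\<close> to the right of \<open>u\<close>, so this shift costs
      at most \<open>e / 2\<close>.\<close>
  define d where "d = e / 2 * (norm u)\<^sup>2"
  have d: "0 < d"
    using e assms by (simp add: d_def)
  have shift: "norm (newton_rem n u - newton_rem n (u + of_real d)) \<le> e / 2" for n
  proof -
    \<comment> \<open>The horizontal ray from \<open>u\<close> to the right, as an intersection of half-planes.\<close>
    define S where "S = {z. Im u \<le> Im z} \<inter> {z. Im z \<le> Im u} \<inter> {z. Re u \<le> Re z}"
    have ge: "norm u \<le> norm z" "z \<noteq> 0" "0 \<le> Re z" if "z \<in> S" for z
    proof -
      show "norm u \<le> norm z"
        using that assms unfolding S_def cmod_def by (auto intro!: power_mono)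
      then show "z \<noteq> 0" "0 \<le> Re z"
        using that assms by (auto simp: S_def)
    qed
    have "norm (newton_rem n u - newton_rem n (u + of_real d)) \<le> 1 / (norm u)\<^sup>2 * norm (u - (u + of_real d))"
    proof (rule field_differentiable_bound[where S = S and f' = "\<lambda>s. - (beta_kernel n s / s)"])
      show "convex S"
        unfolding S_def by (intro convex_Int convex_halfspace_Re_ge convex_halfspace_Im_ge convex_halfspace_Im_le)
      show "(newton_rem n has_field_derivative - (beta_kernel n z / z)) (at z within S)" if "z \<in> S" for z
        using ge(2,3)[OF that] by (rule has_field_derivative_at_within[OF has_field_derivative_newton_rem])
      show "norm (- (beta_kernel n z / z)) \<le> 1 / (norm u)\<^sup>2" if "z \<in> S" for z
      proof -
        have "norm (beta_kernel n z) \<le> 1 / norm z"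
          using ge(2,3)[OF that] by (intro norm_beta_kernel_le_inverse)
        also have "\<dots> \<le> 1 / norm u"
          using ge[OF that] assms by (intro frac_le) auto
        finally have "norm (- (beta_kernel n z / z)) \<le> 1 / norm u / norm u"
          unfolding norm_minus_cancel norm_divide
          using ge[OF that] assms by (intro frac_le) auto
        then show ?thesis by (simp add: power2_eq_square)
      qed
    qed (use d in \<open>auto simp: S_def\<close>)
    also have "\<dots> = e / 2"
      using assms e by (simp add: d_def norm_mult norm_power)
    finally show ?thesis .
  qed
  have "eventually (\<lambda>n. beta_kernel n (Re u + d) < e / 2) sequentially"
    using e d assms by (intro order_tendstoD(2)[OF beta_kernel_tendsto_0]) auto
  then show "eventually (\<lambda>n. dist (newton_rem n u) 0 < e) sequentially"
  proof eventually_elim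
    case (elim n)
    have "norm (newton_rem n u) \<le> norm (newton_rem n u - newton_rem n (u + of_real d))
        + norm (newton_rem n (u + of_real d))"
      by (metis diff_add_cancel norm_triangle_ineq)
    also have "norm (newton_rem n (u + of_real d)) \<le> beta_kernel n (Re u + d)"
      using norm_newton_rem_le[of "u + of_real d" n] d assms by simp
    finally show ?case
      using shift[of n] elim by simp
  qed
qed

lemma newton_series_sums:
  assumes "u \<noteq> 0" "0 \<le> Re u"
  shows "(\<lambda>k. alt_diff (Suc k) ln u / of_nat (Suc k)) sums (- 1 / u)"
proof -
  have "(\<lambda>n. newton_rem n u - 1 / u) \<longlonglongrightarrow> 0 - 1 / u"
    by (intro tendsto_intros newton_rem_tendsto_0 assms)
  then show ?thesis
    by (simp add: sums_def newton_rem_def)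
qed

section \<open>The digamma series\<close>

text \<open>The \<open>k\<close>-th term of the series whose sum is to be identified with \<open>Digamma u\<close>.\<close>

definition log_mean_term :: "complex \<Rightarrow> nat \<Rightarrow> complex" where
  "log_mean_term u k = alt_diff k ln u / of_nat (Suc k)"

text \<open>
  The terms at \<open>u\<close> and \<open>u + 1\<close> differ exactly by the terms of the Newton series.
\<close>

lemma log_mean_sums_shift:
  assumes "u \<noteq> 0" "0 \<le> Re u" "log_mean_term (u + 1) sums c"
  shows "log_mean_term u sums (c - 1 / u)"
proof -
  have "(\<lambda>k. log_mean_term (u + 1) k + alt_diff (Suc k) ln u / of_nat (Suc k)) sums (c + (- 1 / u))"
    by (intro sums_add assms newton_series_sums)
  then show ?thesis
    by (simp add: log_mean_term_def[abs_def] alt_diff_Suc diff_divide_distrib)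
qed

text \<open>
  The constant \<open>C\<close> does not depend on \<open>u\<close>: the term with index \<open>k > 0\<close> is bounded by
  \<open>2 / (k + 1)\<^sup>2 / Re u\<close>, and the term with index 0 is \<open>ln u\<close>.
\<close>

lemma log_mean_summable:
  obtains C where "\<And>u. 1 \<le> Re u \<Longrightarrow> summable (log_mean_term u)"
    and "\<And>u. 1 \<le> Re u \<Longrightarrow> norm (suminf (log_mean_term u) - ln u) \<le> C / Re u"
proof
  define b where "b k = 2 * inverse (real (k + 2) ^ 2)" for k
  have b: "summable b"
    unfolding b_def by (intro summable_mult summable_ignore_initial_segment inverse_power_summable) auto
  fix u :: complex assume u: "1 \<le> Re u"
  have le: "norm (log_mean_term u (Suc k)) \<le> b k / Re u" for k
  proof -
    have "norm (log_mean_term u (Suc k)) = norm (alt_diff (Suc k) ln u) / real (k + 2)"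
      by (simp add: log_mean_term_def norm_divide del: of_nat_Suc)
    also have "\<dots> \<le> 2 / real (k + 2) / Re u / real (k + 2)"
      by (intro divide_right_mono norm_alt_diff_ln_le u) auto
    also have "\<dots> = b k / Re u"
      by (simp add: b_def power2_eq_square field_simps)
    finally show ?thesis .
  qed
  have bu: "summable (\<lambda>k. b k / Re u)"
    using b by (rule summable_divide)
  have sm: "summable (\<lambda>k. norm (log_mean_term u (Suc k)))"
    by (rule summable_comparison_test'[OF bu]) (use le in auto)
  show "summable (log_mean_term u)"
    using summable_norm_cancel[OF sm] by (simp only: summable_Suc_iff)
  then have "suminf (log_mean_term u) - ln u = (\<Sum>k. log_mean_term u (Suc k))"
    by (subst suminf_split_head) (auto simp: log_mean_term_def)
  also have "norm \<dots> \<le> (\<Sum>k. norm (log_mean_term u (Suc k)))"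
    by (rule summable_norm[OF sm])
  also have "\<dots> \<le> (\<Sum>k. b k / Re u)"
    by (rule suminf_le[OF le sm bu])
  also have "\<dots> = suminf b / Re u"
    by (rule suminf_divide[OF b])
  finally show "norm (suminf (log_mean_term u) - ln u) \<le> suminf b / Re u" .
qed

text \<open>
  The limit formula \<open>Digamma_LIMSEQ\<close> characterises the digamma function among the solutions of
  \<open>F(u) = F(u + 1) - 1 / u\<close> by the asymptotics \<open>F(u + n) - ln n \<rightarrow> 0\<close>.
\<close>

lemma log_mean_sums_Digamma:
  assumes "1 \<le> Re u"
  shows "log_mean_term u sums Digamma u"
proof -
  have u: "u \<noteq> 0"
    using assms by auto
  obtain C where sm: "\<And>v. 1 \<le> Re v \<Longrightarrow> summable (log_mean_term v)"
    and C: "\<And>v. 1 \<le> Re v \<Longrightarrow> norm (suminf (log_mean_term v) - ln v) \<le> C / Re v"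
    using log_mean_summable by blast
  define F where "F v = suminf (log_mean_term v)" for v
  have step: "F v = F (v + 1) - 1 / v" if "1 \<le> Re v" for v
    unfolding F_def using that sm[of "v + 1"]
    by (intro sums_unique[symmetric] log_mean_sums_shift summable_sums) auto
  have F: "F u = F (u + of_nat n) - (\<Sum>k<n. inverse (u + of_nat k))" for n
  proof (induction n)
    case (Suc n)
    then show ?case
      using step[of "u + of_nat n"] assms by (simp add: inverse_eq_divide add_ac)
  qed simp
  have "(\<lambda>n. F (u + of_nat n) - ln (u + of_nat n)) \<longlonglongrightarrow> 0"
  proof (rule Lim_null_comparison)
    show "eventually (\<lambda>n. norm (F (u + of_nat n) - ln (u + of_nat n)) \<le> C / (Re u + real n)) sequentially"
      using C[of "u + of_nat _"] assms by (auto simp: F_def intro!: always_eventually)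
    show "(\<lambda>n. C / (Re u + real n)) \<longlonglongrightarrow> 0"
      by (intro tendsto_divide_0[OF tendsto_const] filterlim_at_top_imp_at_infinity
          filterlim_tendsto_add_at_top[OF tendsto_const] filterlim_real_sequentially)
  qed
  moreover have "(\<lambda>n. ln (u + of_nat n) - ln (of_nat n)) \<longlonglongrightarrow> 0"
  proof (rule Lim_transform_eventually)
    have "(\<lambda>n. ln (1 + u / of_nat n)) \<longlonglongrightarrow> ln (1 + 0)"
      by (intro tendsto_Ln tendsto_add tendsto_const tendsto_divide_0[OF tendsto_const] tendsto_of_nat) auto
    then show "(\<lambda>n. ln (1 + u / of_nat n)) \<longlonglongrightarrow> 0"
      by simp
    show "eventually (\<lambda>n. ln (1 + u / of_nat n) = ln (u + of_nat n) - ln (of_nat n)) sequentially"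
      using eventually_gt_at_top[of 0]
    proof eventually_elim
      case (elim n)
      have "u + of_nat n \<noteq> 0"
        using add_of_nat_neq_0[OF u] assms by simp
      then have "1 + u / of_nat n \<noteq> 0"
        using elim by (simp add: field_simps)
      then have "ln (of_nat n * (1 + u / of_nat n)) = ln (of_nat n) + ln (1 + u / of_nat n)"
        using Ln_times_of_nat[OF elim] Ln_of_nat[OF elim] by simp
      moreover have "of_nat n * (1 + u / of_nat n) = u + of_nat n"
        using elim by (simp add: field_simps)
      ultimately show ?case
        by simp
    qed
  qed
  moreover have "(\<lambda>n. of_real (ln (real n)) - (\<Sum>k<n. inverse (u + of_nat k))) \<longlonglongrightarrow> Digamma u"
    using assms by (intro Digamma_LIMSEQ) auto
  ultimately have "(\<lambda>n. (F (u + of_nat n) - ln (u + of_nat n)) + (ln (u + of_nat n) - ln (of_nat n))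
      + (of_real (ln (real n)) - (\<Sum>k<n. inverse (u + of_nat k)))) \<longlonglongrightarrow> 0 + 0 + Digamma u"
    by (intro tendsto_add)
  moreover have "eventually (\<lambda>n. (F (u + of_nat n) - ln (u + of_nat n)) + (ln (u + of_nat n) - ln (of_nat n))
      + (of_real (ln (real n)) - (\<Sum>k<n. inverse (u + of_nat k))) = F u) sequentially"
    using eventually_gt_at_top[of 0]
  proof eventually_elim
    case (elim n)
    then have "of_real (ln (real n)) = (ln (of_nat n) :: complex)"
      using Ln_of_real[of "real n"] by simp
    then show ?case
      using F[of n] by simp
  qed
  ultimately have "(\<lambda>n. F u) \<longlonglongrightarrow> Digamma u"
    by (simp add: tendsto_cong)
  then have "F u = Digamma u"
    by (simp add: LIMSEQ_const_iff)
  then show ?thesis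
    using summable_sums[OF sm[OF assms]] by (simp add: F_def)
qed

theorem mainTheorem1:
  fixes u :: complex
  assumes "u \<notin> \<int>\<^sub>\<le>\<^sub>0" and "0 \<le> Re u"
  shows "(\<lambda>k. 1 / of_nat (k + 1) *
           (\<Sum>j=0..k. of_nat (k choose j) * (-1) ^ j * ln (u + of_nat j))) sums Digamma u"
proof -
  have u: "u \<noteq> 0"
    using assms by auto
  have "log_mean_term u sums (Digamma (u + 1) - 1 / u)"
    using assms by (intro log_mean_sums_shift log_mean_sums_Digamma u) auto
  also have "Digamma (u + 1) - 1 / u = Digamma u"
    using Digamma_plus1[OF u] by simp
  finally show ?thesis
    by (simp add: log_mean_term_def[abs_def] alt_diff_def)
qed

end
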